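(* Let $\mathbb{k}$ be a field. If $M\in\mathrm{rep}_0(\mathbb{Z}^2)$, then $\dim M-\dim\mathbf{x}M-\dim\mathbf{y}M+\dim\mathbf{x}\mathbf{y}M\ge 0$.
   Context: $\mathrm{rep}_0(\mathbb{Z}^2)$ is the category of functors from $\mathbb{Z}^2$ (product order) to finite dimensional $\mathbb{k}$-vector spaces with finite support, identified with finite dimensional bigraded $\mathbb{k}[\mathbf{x},\mathbf{y}]$-modules, where $\mathbf{x}:M_i\to M_{i+(1,0)}$ and $\mathbf{y}:M_i\to M_{i+(0,1)}$ are the structure maps. Dimensions are total dimensions over $\mathbb{k}$. *)

theory Defs
  imports
    "Jordan_Normal_Form.Missing_VectorSpace"
    "HOL-Library.Product_Order"
begin

text \<open>
  An object \<open>(M, \<phi>)\<close> of \<open>rep\<^sub>0(\<int>\<^sup>2)\<close> over the field \<open>K\<close>: a functor from \<open>\<int> \<times> \<int>\<close> with the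
  product order to finite-dimensional \<open>K\<close>-vector spaces, with finite support. Each \<open>M i\<close> is a
  vector space with its own operations. As HOL functions are total, \<open>\<phi> i j\<close> matters only for
  \<open>i \<le> j\<close> and on \<open>carrier (M i)\<close>, and the functor laws are equations on carriers.
\<close>

locale rep0 = field K
  for K :: "('k, 'c) ring_scheme" +
  fixes M :: "int \<times> int \<Rightarrow> ('k, 'v) module"
    and \<phi> :: "int \<times> int \<Rightarrow> int \<times> int \<Rightarrow> 'v \<Rightarrow> 'v"
  assumes vs: "vectorspace K (M i)"
    and fd: "vectorspace.fin_dim K (M i)"
    and finite_support: "finite {i. carrier (M i) \<noteq> {\<zero>\<^bsub>M i\<^esub>}}"
    and lin: "i \<le> j \<Longrightarrow> linear_map K (M i) (M j) (\<phi> i j)"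
    and map_id: "v \<in> carrier (M i) \<Longrightarrow> \<phi> i i v = v"
    and map_comp:
      "\<lbrakk>i \<le> j; j \<le> k; v \<in> carrier (M i)\<rbrakk> \<Longrightarrow> \<phi> j k (\<phi> i j v) = \<phi> i k v"

text \<open>
  Graded submodules of the bigraded module \<open>\<Oplus>i. M i\<close> are given by their homogeneous components
  \<open>N i \<subseteq> carrier (M i)\<close>. Since \<open>x\<close> and \<open>y\<close> have degrees \<open>(1,0)\<close> and \<open>(0,1)\<close>, the components of
  \<open>xN\<close> and \<open>yN\<close> in degree \<open>(a, b)\<close> are the images of those of \<open>N\<close> in degrees
  \<open>(a - 1, b)\<close> and \<open>(a, b - 1)\<close>.
\<close>

definition whole :: "(int \<times> int \<Rightarrow> ('k, 'v) module) \<Rightarrow> int \<times> int \<Rightarrow> 'v set" where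
  "whole M = (\<lambda>i. carrier (M i))"

definition x_image ::
    "(int \<times> int \<Rightarrow> int \<times> int \<Rightarrow> 'v \<Rightarrow> 'v) \<Rightarrow> (int \<times> int \<Rightarrow> 'v set) \<Rightarrow> int \<times> int \<Rightarrow> 'v set" where
  "x_image \<phi> N = (\<lambda>(a, b). \<phi> (a - 1, b) (a, b) ` N (a - 1, b))"

definition y_image ::
    "(int \<times> int \<Rightarrow> int \<times> int \<Rightarrow> 'v \<Rightarrow> 'v) \<Rightarrow> (int \<times> int \<Rightarrow> 'v set) \<Rightarrow> int \<times> int \<Rightarrow> 'v set" where
  "y_image \<phi> N = (\<lambda>(a, b). \<phi> (a, b - 1) (a, b) ` N (a, b - 1))"

text \<open>
  The sum ranges over the support of \<open>N\<close>, which is finite for a graded submodule of an object of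
  \<open>rep\<^sub>0(\<int>\<^sup>2)\<close>.
\<close>

definition total_dim ::
    "('k, 'c) ring_scheme \<Rightarrow> (int \<times> int \<Rightarrow> ('k, 'v) module) \<Rightarrow> (int \<times> int \<Rightarrow> 'v set) \<Rightarrow> nat" where
  "total_dim K M N =
    (\<Sum>i | N i \<noteq> {\<zero>\<^bsub>M i\<^esub>}. vectorspace.dim K (M i\<lparr>carrier := N i\<rparr>))"

context rep0
begin

definition graded_submodule :: "(int \<times> int \<Rightarrow> 'v set) \<Rightarrow> bool" where
  "graded_submodule N \<longleftrightarrow>
    (\<forall>i. subspace K (N i) (M i)) \<and> (\<forall>i j. i \<le> j \<longrightarrow> \<phi> i j ` N i \<subseteq> N j)"

lemma graded_submoduleD:
  assumes "graded_submodule N"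
  shows "subspace K (N i) (M i)" "i \<le> j \<Longrightarrow> \<phi> i j ` N i \<subseteq> N j"
    "N i \<subseteq> carrier (M i)" "\<zero>\<^bsub>M i\<^esub> \<in> N i"
proof -
  show sub: "subspace K (N i) (M i)" and "i \<le> j \<Longrightarrow> \<phi> i j ` N i \<subseteq> N j"
    using assms unfolding graded_submodule_def by blast+
  interpret submodule K "N i" "M i" using sub by (rule subspace.submod)
  show "N i \<subseteq> carrier (M i)" "\<zero>\<^bsub>M i\<^esub> \<in> N i" by (rule subset, rule zero_closed)
qed

lemma finite_support_graded_submodule:
  assumes "graded_submodule N"
  shows "finite {i. N i \<noteq> {\<zero>\<^bsub>M i\<^esub>}}"
proof (rule finite_subset[OF _ finite_support])
  have "N i \<subseteq> carrier (M i)" "\<zero>\<^bsub>M i\<^esub> \<in> N i" for i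
    using graded_submoduleD[OF assms] by blast+
  then show "{i. N i \<noteq> {\<zero>\<^bsub>M i\<^esub>}} \<subseteq> {i. carrier (M i) \<noteq> {\<zero>\<^bsub>M i\<^esub>}}"
    by blast
qed

lemma subspace_image:
  assumes "i \<le> j" "subspace K W (M i)"
  shows "subspace K (\<phi> i j ` W) (M j)"
proof -
  interpret T: linear_map K "M i" "M j" "\<phi> i j" by (rule lin[OF assms(1)])
  interpret W: submodule K W "M i" using assms(2) by (simp add: subspace_def)
  have sub: "W \<subseteq> carrier (M i)" by (rule W.subset)
  show ?thesis
  proof (unfold subspace_def, intro conjI vs, unfold_locales)
    show "\<phi> i j ` W \<subseteq> carrier (M j)" using sub T.f_im by auto
    show "\<zero>\<^bsub>M j\<^esub> \<in> \<phi> i j ` W"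
      using W.zero_closed T.f0_is_0 by (metis image_eqI)
    fix v w assume "v \<in> \<phi> i j ` W" "w \<in> \<phi> i j ` W"
    then obtain v' w' where *: "v' \<in> W" "w' \<in> W" "v = \<phi> i j v'" "w = \<phi> i j w'" by auto
    then have "v \<oplus>\<^bsub>M j\<^esub> w = \<phi> i j (v' \<oplus>\<^bsub>M i\<^esub> w')"
      using sub T.f_add[of v' w'] by (simp add: subset_iff)
    then show "v \<oplus>\<^bsub>M j\<^esub> w \<in> \<phi> i j ` W" using * W.m_closed by blast
  next
    fix c v assume c: "c \<in> carrier K" and "v \<in> \<phi> i j ` W"
    then obtain v' where *: "v' \<in> W" "v = \<phi> i j v'" by auto
    then have "c \<odot>\<^bsub>M j\<^esub> v = \<phi> i j (c \<odot>\<^bsub>M i\<^esub> v')" using sub c T.f_smult by auto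
    then show "c \<odot>\<^bsub>M j\<^esub> v \<in> \<phi> i j ` W" using * c W.smult_closed by blast
  qed
qed

lemma graded_submodule_whole: "graded_submodule (whole M)"
proof -
  have "subspace K (carrier (M i)) (M i)" for i
  proof -
    interpret vectorspace K "M i" by (rule vs)
    show ?thesis unfolding subspace_def by (intro conjI vs, unfold_locales) auto
  qed
  moreover have "\<phi> i j ` carrier (M i) \<subseteq> carrier (M j)" if "i \<le> j" for i j
  proof -
    interpret linear_map K "M i" "M j" "\<phi> i j" by (rule lin[OF that])
    show ?thesis using f_im by auto
  qed
  ultimately show ?thesis by (simp add: graded_submodule_def whole_def)
qed

lemma graded_submodule_shifted_image:
  assumes N: "graded_submodule N" and s: "\<And>i. s i \<le> i" "mono s"
  shows "graded_submodule (\<lambda>i. \<phi> (s i) i ` N (s i))"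
  unfolding graded_submodule_def
proof (intro conjI allI impI)
  show "subspace K (\<phi> (s i) i ` N (s i)) (M i)" for i
    by (rule subspace_image[OF s(1) graded_submoduleD(1)[OF N]])
  fix i j :: "int \<times> int" assume ij: "i \<le> j"
  then have s_ij: "s i \<le> s j" by (rule monoD[OF s(2)])
  show "\<phi> i j ` \<phi> (s i) i ` N (s i) \<subseteq> \<phi> (s j) j ` N (s j)"
  proof (clarify)
    fix v assume v: "v \<in> N (s i)"
    have "v \<in> carrier (M (s i))"
      using graded_submoduleD(3)[OF N] v by blast
    then have "\<phi> i j (\<phi> (s i) i v) = \<phi> (s j) j (\<phi> (s i) (s j) v)"
      using map_comp s(1) ij s_ij by simp
    moreover have "\<phi> (s i) (s j) v \<in> N (s j)"
      using graded_submoduleD(2)[OF N s_ij] v by blast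
    ultimately show "\<phi> i j (\<phi> (s i) i v) \<in> \<phi> (s j) j ` N (s j)" by simp
  qed
qed

lemma graded_submodule_x_image:
  assumes "graded_submodule N"
  shows "graded_submodule (x_image \<phi> N)"
proof -
  have "graded_submodule (\<lambda>i. \<phi> ((\<lambda>(a, b). (a - 1, b)) i) i ` N ((\<lambda>(a, b). (a - 1, b)) i))"
    by (rule graded_submodule_shifted_image[OF assms])
      (auto simp: mono_def less_eq_prod_def)
  moreover have "(\<lambda>i. \<phi> ((\<lambda>(a, b). (a - 1, b)) i) i ` N ((\<lambda>(a, b). (a - 1, b)) i)) = x_image \<phi> N"
    by (rule ext) (auto simp: x_image_def)
  ultimately show ?thesis by simp
qed

lemma graded_submodule_y_image:
  assumes "graded_submodule N"
  shows "graded_submodule (y_image \<phi> N)"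
proof -
  have "graded_submodule (\<lambda>i. \<phi> ((\<lambda>(a, b). (a, b - 1)) i) i ` N ((\<lambda>(a, b). (a, b - 1)) i))"
    by (rule graded_submodule_shifted_image[OF assms])
      (auto simp: mono_def less_eq_prod_def)
  moreover have "(\<lambda>i. \<phi> ((\<lambda>(a, b). (a, b - 1)) i) i ` N ((\<lambda>(a, b). (a, b - 1)) i)) = y_image \<phi> N"
    by (rule ext) (auto simp: y_image_def)
  ultimately show ?thesis by simp
qed

end

end

(*
  The difference dim M - dim xM is the dimension of the kernel of x on M, and dim yM - dim xyM
  is the dimension of the kernel of x on the submodule yM, a subspace of the former. Both are
  computed degree by degree with the rank-nullity theorem.
*)
theory Submission
  imports Defs "Jordan_Normal_Form.DL_Rank"
begin

text \<open>Independent subsets of \<open>U\<close> stay independent in \<open>V\<close>, so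
  \<open>dim\<close> bounds their size. Hence a maximal one exists, and it is a finite generating
  set of \<open>U\<close>.\<close>

lemma (in vectorspace) fin_dim_subspace:
  assumes U: "subspace K U V" and fd: "fin_dim"
  shows "vectorspace.fin_dim K (vs U)"
proof -
  interpret U: vectorspace K "vs U"
    by (rule subspace_is_vs[OF U])
  have sub: "submodule K U V"
    by (rule is_module[OF U])
  have U_sub: "U \<subseteq> carrier V"
    by (rule submodule.subset[OF sub])
  have indpt: "U.lin_indpt A \<longleftrightarrow> lin_indpt A" if "A \<subseteq> U" for A
    using span_li_not_depend(2)[OF that sub] by simp
  let ?P = "\<lambda>A. A \<subseteq> U \<and> U.lin_indpt A"
  have bound: "finite A \<and> card A \<le> dim" if "?P A" for A
    using li_le_dim[OF fd, of A] that indpt U_sub by auto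
  have "\<exists>A. finite A \<and> maximal A ?P"
  proof (rule maximal_exists)
    show "finite A \<and> card A \<le> dim" if "?P A" for A
      by (rule bound[OF that])
    show "?P {}"
      by (auto simp: U.lin_dep_def)
  qed
  then obtain A where A: "finite A" "maximal A ?P"
    by blast
  have "U.gen_set A"
    by (rule U.max_li_is_gen) (use A(2) in simp)
  moreover have "A \<subseteq> U"
    using A(2) by (simp add: maximal_def)
  ultimately show ?thesis
    using A(1) by (auto simp: U.fin_dim_def)
qed

context linear_map
begin

lemma linear_map_subspace:
  assumes "subspace K U V"
  shows "linear_map K (V.vs U) W T"
proof -
  interpret U: vectorspace K "V.vs U"
    by (rule V.subspace_is_vs[OF assms])
  have "U \<subseteq> carrier V"
    using V.is_module[OF assms] by (rule submodule.subset)
  then have "T \<in> LinearCombinations.module_hom K (V.vs U) W"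
    by (simp add: LinearCombinations.module_hom_def subset_iff)
  then show ?thesis
    by unfold_locales
qed

text \<open>By rank-nullity on \<open>V\<close> and on \<open>U\<close>, this says that the kernel
  of \<open>T\<close> restricted to \<open>U\<close> has dimension at most that of
  \<open>kerT\<close>. The terms are arranged to avoid subtraction of naturals.\<close>

lemma nullity_subspace_le:
  assumes fd: "V.fin_dim" and U: "subspace K U V"
  shows "vectorspace.dim K (V.vs U) + vectorspace.dim K (W.vs (T ` carrier V))
    \<le> V.dim + vectorspace.dim K (W.vs (T ` U))"
proof -
  interpret U: linear_map K "V.vs U" W T
    by (rule linear_map_subspace[OF U])
  interpret ker: vectorspace K "V.vs kerT"
    by (rule V.subspace_is_vs[OF kerT_is_subspace])
  have sub: "submodule K U V"
    by (rule V.is_module[OF U])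
  have U_sub: "U \<subseteq> carrier V"
    by (rule submodule.subset[OF sub])
  have fd_U: "vectorspace.fin_dim K (V.vs U)"
    by (rule V.fin_dim_subspace[OF U fd])
  have ker_le: "U.kerT \<subseteq> kerT"
    using U_sub by (auto simp: ker_def U.ker_def)
  \<comment> \<open>The kernel of the restriction is at first a submodule of \<open>V.vs U\<close>.
    Since \<open>V.vs U\<close> has the operations of \<open>V\<close>, it is one of
    \<open>V\<close> too, and so can be placed inside \<open>kerT\<close>.\<close>
  have "submodule K U.kerT V"
    using U.ker_is_submodule U_sub sub by (auto simp: submodule_def)
  then have kerU: "subspace K U.kerT V"
    by (simp add: subspace_def V.vectorspace_axioms)
  have "subspace K U.kerT (V.vs kerT)"
    by (rule V.nested_subspaces[OF kerT_is_subspace kerU ker_le])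
  from ker.subspace_dim[OF this V.fin_dim_subspace[OF kerT_is_subspace fd]]
    ker.fin_dim_subspace[OF this V.fin_dim_subspace[OF kerT_is_subspace fd]]
  have "vectorspace.dim K (V.vs U.kerT) \<le> ker.dim"
    by simp
  with rank_nullity[OF fd] U.rank_nullity[OF fd_U] show ?thesis
    by (simp add: im_def U.im_def)
qed

end

context rep0
begin

lemma dim_zero_space: "vectorspace.dim K (M i\<lparr>carrier := {\<zero>\<^bsub>M i\<^esub>}\<rparr>) = 0"
proof -
  interpret V: vectorspace K "M i" by (rule vs)
  have "subspace K {\<zero>\<^bsub>M i\<^esub>} (M i)"
    using V.span_is_subspace[of "{}"] by (simp add: V.span_empty)
  then interpret Z: vectorspace K "V.vs {\<zero>\<^bsub>M i\<^esub>}"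
    by (rule V.subspace_is_vs)
  have "Z.gen_set {\<zero>\<^bsub>M i\<^esub>}"
    using Z.span_is_subset2[of "{\<zero>\<^bsub>M i\<^esub>}"] Z.span_zero[of "{\<zero>\<^bsub>M i\<^esub>}"] by auto
  then show ?thesis
    using Z.dim0I by simp
qed

text \<open>The index set in \<open>total_dim\<close> varies with \<open>N\<close>. Zero spaces
  contribute nothing, so sums for several submodules can share one finite set
  \<open>S\<close>.\<close>

lemma total_dim_eq_sum:
  assumes "finite S" "\<And>i. i \<notin> S \<Longrightarrow> N i = {\<zero>\<^bsub>M i\<^esub>}"
  shows "total_dim K M N = (\<Sum>i\<in>S. vectorspace.dim K (M i\<lparr>carrier := N i\<rparr>))"
  unfolding total_dim_def
  by (rule sum.mono_neutral_left) (use assms dim_zero_space in auto)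

text \<open>The image under x lives on \<open>S\<close> shifted by \<open>(1, 0)\<close>. Reindexing
  by the source degree puts each summand beside the space that x is applied to, as rank-nullity
  requires.\<close>

lemma total_dim_x_image:
  assumes "finite S" "\<And>i. i \<notin> S \<Longrightarrow> N i = {\<zero>\<^bsub>M i\<^esub>}"
  shows "total_dim K M (x_image \<phi> N) =
    (\<Sum>i\<in>S. vectorspace.dim K (M (i + (1, 0))\<lparr>carrier := \<phi> i (i + (1, 0)) ` N i\<rparr>))"
proof -
  have "total_dim K M (x_image \<phi> N) =
    (\<Sum>i\<in>(\<lambda>i. i + (1, 0)) ` S. vectorspace.dim K (M i\<lparr>carrier := x_image \<phi> N i\<rparr>))"
  proof (rule total_dim_eq_sum)
    fix i :: "int \<times> int"
    assume i: "i \<notin> (\<lambda>i. i + (1, 0)) ` S"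
    obtain a b where ab: "i = (a, b)" by fastforce
    \<comment> \<open>Linearity sends zero to zero, so outside the shifted set the image is the zero
      space.\<close>
    interpret linear_map K "M (a - 1, b)" "M (a, b)" "\<phi> (a - 1, b) (a, b)"
      by (rule lin) simp
    have "(a - 1, b) \<notin> S"
    proof
      assume "(a - 1, b) \<in> S"
      then have "(a - 1, b) + (1, 0) \<in> (\<lambda>i. i + (1, 0)) ` S" by (rule imageI)
      with i ab show False by simp
    qed
    then have "N (a - 1, b) = {\<zero>\<^bsub>M (a - 1, b)\<^esub>}"
      by (rule assms(2))
    then show "x_image \<phi> N i = {\<zero>\<^bsub>M i\<^esub>}"
      by (simp add: ab x_image_def)
  qed (use assms(1) in simp)
  also have "\<dots> = (\<Sum>i\<in>S. vectorspace.dim K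
      (M (i + (1, 0))\<lparr>carrier := x_image \<phi> N (i + (1, 0))\<rparr>))"
    by (subst sum.reindex) (auto simp: inj_on_def)
  finally show ?thesis
    by (simp add: x_image_def case_prod_beta plus_prod_def)
qed

text \<open>This is the kernel comparison \<open>nullity_subspace_le\<close> for x in each degree,
  summed over the support of \<open>M\<close>, which contains that of \<open>N\<close>.\<close>

lemma total_dim_submodule_add_x_image_le:
  assumes N: "graded_submodule N"
  shows "total_dim K M N + total_dim K M (x_image \<phi> (whole M))
    \<le> total_dim K M (whole M) + total_dim K M (x_image \<phi> N)"
proof -
  define S where "S = {i. carrier (M i) \<noteq> {\<zero>\<^bsub>M i\<^esub>}}"
  have fin: "finite S"
    using finite_support by (simp add: S_def)
  have whole0: "whole M i = {\<zero>\<^bsub>M i\<^esub>}" if "i \<notin> S" for i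
    using that by (simp add: S_def whole_def)
  have N0: "N i = {\<zero>\<^bsub>M i\<^esub>}" if "i \<notin> S" for i
    using that graded_submoduleD(3,4)[OF N, of i] by (auto simp: S_def)
  have "vectorspace.dim K (M i\<lparr>carrier := N i\<rparr>)
      + vectorspace.dim K (M (i + (1, 0))\<lparr>carrier := \<phi> i (i + (1, 0)) ` whole M i\<rparr>)
    \<le> vectorspace.dim K (M i\<lparr>carrier := whole M i\<rparr>)
      + vectorspace.dim K (M (i + (1, 0))\<lparr>carrier := \<phi> i (i + (1, 0)) ` N i\<rparr>)" for i
  proof -
    interpret linear_map K "M i" "M (i + (1, 0))" "\<phi> i (i + (1, 0))"
      by (rule lin) (simp add: less_eq_prod_def)
    show ?thesis
      using nullity_subspace_le[OF fd graded_submoduleD(1)[OF N]]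
      by (simp add: whole_def)
  qed
  then have "(\<Sum>i\<in>S. vectorspace.dim K (M i\<lparr>carrier := N i\<rparr>)
      + vectorspace.dim K (M (i + (1, 0))\<lparr>carrier := \<phi> i (i + (1, 0)) ` whole M i\<rparr>))
    \<le> (\<Sum>i\<in>S. vectorspace.dim K (M i\<lparr>carrier := whole M i\<rparr>)
      + vectorspace.dim K (M (i + (1, 0))\<lparr>carrier := \<phi> i (i + (1, 0)) ` N i\<rparr>))"
    by (rule sum_mono)
  then show ?thesis
    using total_dim_eq_sum[of S N] total_dim_eq_sum[of S "whole M"]
      total_dim_x_image[of S N] total_dim_x_image[of S "whole M"] fin N0 whole0
    by (simp add: sum.distrib)
qed

end

theorem proposition4p1:
  fixes K :: "('k, 'c) ring_scheme"
    and M :: "int \<times> int \<Rightarrow> ('k, 'v) module"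
    and \<phi> :: "int \<times> int \<Rightarrow> int \<times> int \<Rightarrow> 'v \<Rightarrow> 'v"
  assumes "rep0 K M \<phi>"
  shows "int (total_dim K M (whole M))
       - int (total_dim K M (x_image \<phi> (whole M)))
       - int (total_dim K M (y_image \<phi> (whole M)))
       + int (total_dim K M (x_image \<phi> (y_image \<phi> (whole M)))) \<ge> 0"
proof -
  interpret rep0 K M \<phi> by (rule assms)
  show ?thesis
    \<comment> \<open>With \<open>N\<close> taken as yM, this reads dim yM + dim xM \<le> dim M +
      dim xyM over the naturals.\<close>
    using total_dim_submodule_add_x_image_le[OF graded_submodule_y_image[OF graded_submodule_whole]]
    by linarith
qed

end
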